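(* There is an absolute constant $C \geq 1$ such that the following holds. Let $0 < \delta \leq \epsilon \leq 1$, let $\mathcal{L} \subset \mathcal{Q}_{0}$ be a finite $\epsilon$-separated family of lines, let $k \geq 2$ be an integer, and let $P \subset Q_{0} = [-1,1]^{2}$ be a $\delta$-separated set of points each of which is $k$-rich relative to $\mathcal{L}$. Then $$|P| \leq C\, \frac{|\mathcal{L}|^{2}}{k^{3}} \cdot \epsilon^{-1},$$ where $|\cdot|$ denotes cardinality.
   Context: $Q_{0} := [-1,1]^{2} \subset \mathbb{R}^{2}$. For $(a,b) \in \mathbb{R}^2$ let $\ell_{(a,b)} := \{(x,y) \in \mathbb{R}^{2} : y = ax+b\}$, and let $\mathcal{Q}_{0} := \{\ell_{(a,b)} : |a| \leq 1, |b| \leq 1\}$, equipped with the metric $d(\ell_{(a,b)},\ell_{(c,d)}) := |(a,b)-(c,d)|$ (Euclidean norm). A set of points is $\delta$-separated if any two distinct points $p,q$ in it satisfy $|p-q| \geq \delta$; a family of lines in $\mathcal{Q}_{0}$ is $\epsilon$-separated if any two distinct lines $\ell_1,\ell_2$ in it satisfy $d(\ell_1,\ell_2) \geq \epsilon$. A point $p$ is $\delta$-incident to a line $\ell$, written $p \sim \ell$, if $p \in \ell(\delta) := \{q \in \mathbb{R}^{2} : \operatorname{dist}(q,\ell) \leq \delta\}$. A point $p \in \mathbb{R}^{2}$ is $k$-rich relative to $\mathcal{L}$ if $p \sim \ell$ for at least $k$ distinct lines $\ell \in \mathcal{L}$ (the incidence being at scale $\delta$, not $\epsilon$). *)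

theory Defs
  imports "HOL-Analysis.Analysis"
begin

(* The plane is real \<times> real, whose library metric is the Euclidean one. *)

definition Q0 :: "(real \<times> real) set" where
  "Q0 = {-1..1} \<times> {-1..1}"

definition line :: "real \<times> real \<Rightarrow> (real \<times> real) set" where
  "line = (\<lambda>(a, b). {(x, y). y = a * x + b})"

definition lines_Q0 :: "(real \<times> real) set set" where
  "lines_Q0 = {line (a, b) | a b. \<bar>a\<bar> \<le> 1 \<and> \<bar>b\<bar> \<le> 1}"

(* Meaningful only for non-vertical lines, whose coefficients (a, b) are
   determined by the line, see inj_line and line_dist_line below. *)
definition line_dist :: "(real \<times> real) set \<Rightarrow> (real \<times> real) set \<Rightarrow> real" where
  "line_dist l m = dist (the_inv line l) (the_inv line m)"

definition points_separated :: "real \<Rightarrow> (real \<times> real) set \<Rightarrow> bool" where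
  "points_separated \<delta> P \<longleftrightarrow> (\<forall>p\<in>P. \<forall>q\<in>P. p \<noteq> q \<longrightarrow> \<delta> \<le> dist p q)"

definition lines_separated :: "real \<Rightarrow> (real \<times> real) set set \<Rightarrow> bool" where
  "lines_separated \<epsilon> L \<longleftrightarrow> (\<forall>l\<in>L. \<forall>m\<in>L. l \<noteq> m \<longrightarrow> \<epsilon> \<le> line_dist l m)"

definition nbhd :: "real \<Rightarrow> (real \<times> real) set \<Rightarrow> (real \<times> real) set" where
  "nbhd \<delta> l = {q. infdist q l \<le> \<delta>}"

definition incident :: "real \<Rightarrow> real \<times> real \<Rightarrow> (real \<times> real) set \<Rightarrow> bool" where
  "incident \<delta> p l \<longleftrightarrow> p \<in> nbhd \<delta> l"

(* Intended for finite L; card is 0 on infinite sets. *)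
definition rich :: "real \<Rightarrow> (real \<times> real) set set \<Rightarrow> nat \<Rightarrow> real \<times> real \<Rightarrow> bool" where
  "rich \<delta> L k p \<longleftrightarrow> k \<le> card {l \<in> L. incident \<delta> p l}"

lemma inj_line: "inj line"
proof (rule injI)
  fix p q :: "real \<times> real"
  assume eq: "line p = line q"
  obtain a b c d where pq: "p = (a, b)" "q = (c, d)"
    by (metis surj_pair)
  have "(0, b) \<in> line p" "(1, a + b) \<in> line p"
    by (auto simp: line_def pq)
  then show "p = q"
    unfolding eq by (auto simp: line_def pq)
qed

lemma line_dist_line: "line_dist (line p) (line q) = dist p q"
  by (simp add: line_dist_def the_inv_f_f inj_line)

end

theory Submission
  imports Defs
begin

text \<open>
  Identify a line with its coefficients, so that a point \<open>(x, y)\<close> incident to \<open>(a, b)\<close> lies in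
  the strip \<open>\<bar>y - a x - b\<bar> \<le> 2 \<delta>\<close>; this condition is symmetric under point-line duality.
  A separated set in a short piece of a strip is small. Applied to the lines near a point, this
  shows that a positive proportion of the pairs of lines near a \<open>k\<close>-rich point differ in slope by
  a multiple of \<open>k \<epsilon>\<close>. Applied to the points near two lines whose slopes differ by \<open>\<theta>\<close>, it
  bounds their number by a multiple of \<open>1 / \<theta>\<close>. Counting triples (point, line, line)
  with this slope separation gives the claim; for bounded \<open>k\<close> all pairs of distinct lines are used.
\<close>

section \<open>Incidence in coordinates and separated sets in strips\<close>

definition near :: "real \<Rightarrow> real \<times> real \<Rightarrow> real \<times> real \<Rightarrow> bool" where
  "near \<delta> p l \<longleftrightarrow> \<bar>snd p - fst l * fst p - snd l\<bar> \<le> 2 * \<delta>"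

lemma dist_le_sum_abs:
  fixes p q :: "real \<times> real"
  shows "dist p q \<le> \<bar>fst p - fst q\<bar> + \<bar>snd p - snd q\<bar>"
  using sqrt_sum_squares_le_sum_abs[of "fst p - fst q" "snd p - snd q"]
  by (simp add: dist_prod_def dist_real_def)

text \<open>For \<open>q\<close> on the line, the vertical offset of \<open>p\<close> is at most the
  height difference to \<open>q\<close> plus the slope times the horizontal difference, each at most
  \<open>dist p q\<close> in absolute value. Hence the factor 2 in \<open>near\<close>.\<close>

lemma incident_line_imp_near:
  assumes "\<bar>a\<bar> \<le> 1" "incident \<delta> p (line (a, b))"
  shows "near \<delta> p (a, b)"
proof -
  have ne: "line (a, b) \<noteq> {}" by (auto simp: line_def)
  obtain x y where p: "p = (x, y)" by fastforce
  have "\<bar>y - a * x - b\<bar> / 2 \<le> dist p q" if "q \<in> line (a, b)" for q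
  proof -
    obtain u where q: "q = (u, a * u + b)" using \<open>q \<in> line (a, b)\<close> by (auto simp: line_def)
    have "\<bar>x - u\<bar> \<le> dist p q" "\<bar>y - (a * u + b)\<bar> \<le> dist p q"
      using dist_fst_le[of p q] dist_snd_le[of p q] by (simp_all add: p q dist_real_def)
    moreover have "\<bar>a * (u - x)\<bar> \<le> \<bar>x - u\<bar>"
      using mult_right_mono[OF assms(1), of "\<bar>u - x\<bar>"] by (simp add: abs_mult abs_minus_commute)
    ultimately have "\<bar>y - (a * u + b)\<bar> + \<bar>a * (u - x)\<bar> \<le> 2 * dist p q" by linarith
    moreover have "\<bar>y - a * x - b\<bar> \<le> \<bar>y - (a * u + b)\<bar> + \<bar>a * (u - x)\<bar>"
      using abs_triangle_ineq[of "y - (a * u + b)" "a * (u - x)"] by (simp add: algebra_simps)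
    ultimately have "\<bar>y - a * x - b\<bar> \<le> 2 * dist p q" by (rule order_trans[rotated])
    then show ?thesis by simp
  qed
  then have "\<bar>y - a * x - b\<bar> / 2 \<le> infdist p (line (a, b))"
    using ne unfolding infdist_notempty[OF ne] by (intro cINF_greatest)
  then show ?thesis using assms(2) by (simp add: near_def p incident_def nbhd_def)
qed

text \<open>Shear the strip to the coordinates \<open>u\<close> and \<open>v - m * u - c\<close> and
  cut it into square cells of side \<open>r / 4\<close>. Two points of \<open>S\<close> in one cell
  would be less than \<open>3 * r / 4\<close> apart, so each cell holds at most one. The strip is
  left general because it serves both for points near a line and, dually, for lines near a
  point.\<close>

lemma separated_strip_card:
  fixes S :: "(real \<times> real) set"
  assumes r: "0 < r" and sep: "points_separated r S" and m: "\<bar>m\<bar> \<le> 1" and W: "0 \<le> W"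
    and S: "\<And>u v. (u, v) \<in> S \<Longrightarrow> s \<le> u \<and> u \<le> s + W \<and> \<bar>v - m * u - c\<bar> \<le> 2 * r"
  shows "finite S \<and> real (card S) \<le> 17 * (4 * W / r + 2)"
proof -
  define f where "f = (\<lambda>(u, v). (\<lfloor>4 * u / r\<rfloor>, \<lfloor>4 * (v - m * u - c) / r\<rfloor>))"
  \<comment> \<open>Offsets between \<open>-2 * r\<close> and \<open>2 * r\<close> give 17 row
    indices; index 8 is attained only at the upper end. The rounding of the columns causes the
    summand 2 in the bound.\<close>
  define B :: "(int \<times> int) set"
    where "B = {\<lfloor>4 * s / r\<rfloor>..\<lfloor>4 * (s + W) / r\<rfloor>} \<times> {-8..8}"
  have floor_eq: "\<bar>x - y\<bar> < r / 4" if "\<lfloor>4 * x / r\<rfloor> = \<lfloor>4 * y / r\<rfloor>" for x y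
  proof -
    have "\<bar>4 * x / r - 4 * y / r\<bar> < 1" using that by linarith
    moreover have "\<bar>4 * x / r - 4 * y / r\<bar> = 4 * \<bar>x - y\<bar> / r"
      using r unfolding diff_divide_distrib[symmetric] right_diff_distrib[symmetric]
        abs_divide abs_mult by simp
    ultimately show ?thesis using r by (simp add: divide_less_eq)
  qed
  have "inj_on f S"
  proof (rule inj_onI, rule ccontr)
    fix p q assume pq: "p \<in> S" "q \<in> S" "f p = f q" "p \<noteq> q"
    obtain x y u v where p: "p = (x, y)" and q: "q = (u, v)" by fastforce
    have 1: "\<bar>x - u\<bar> < r / 4" and 2: "\<bar>(y - m * x - c) - (v - m * u - c)\<bar> < r / 4"
      using pq(3) unfolding f_def p q by (intro floor_eq; simp only: prod.case prod.inject)+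
    have "\<bar>m * (x - u)\<bar> \<le> \<bar>x - u\<bar>"
      using mult_right_mono[OF m, of "\<bar>x - u\<bar>"] by (simp add: abs_mult)
    moreover have "y - v = ((y - m * x - c) - (v - m * u - c)) + m * (x - u)"
      by (simp add: algebra_simps)
    ultimately have "\<bar>y - v\<bar> < r / 2" using 1 2 by linarith
    moreover have "dist p q \<le> \<bar>x - u\<bar> + \<bar>y - v\<bar>" using dist_le_sum_abs[of p q] by (simp add: p q)
    ultimately have "dist p q < r" using 1 r by linarith
    then show False using sep pq by (force simp: points_separated_def)
  qed
  moreover have "f ` S \<subseteq> B"
  proof -
    have "f (u, v) \<in> B" if "(u, v) \<in> S" for u v
    proof -
      have b: "s \<le> u" "u \<le> s + W" "\<bar>v - m * u - c\<bar> \<le> 2 * r" using S[OF that] by auto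
      have "4 * s / r \<le> 4 * u / r" "4 * u / r \<le> 4 * (s + W) / r"
        using b(1,2) r by (intro divide_right_mono; simp)+
      moreover have "-8 \<le> 4 * (v - m * u - c) / r" "4 * (v - m * u - c) / r \<le> 8"
        using b(3) r by (simp_all add: le_divide_eq divide_le_eq)
      ultimately show ?thesis
        unfolding f_def B_def prod.case mem_Times_iff fst_conv snd_conv atLeastAtMost_iff
        by (intro conjI floor_mono) (simp_all add: le_floor_iff floor_le_iff)
    qed
    then show ?thesis by auto
  qed
  moreover have "finite B" by (simp add: B_def)
  ultimately have fin: "finite S" and card: "card S \<le> card B"
    by (metis finite_imageD finite_subset, metis card_inj_on_le)
  have "4 * s / r \<le> 4 * (s + W) / r" using W r by (intro divide_right_mono) auto
  then have "\<lfloor>4 * s / r\<rfloor> \<le> \<lfloor>4 * (s + W) / r\<rfloor>" by (rule floor_mono)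
  then have "real (card B) = 17 * (real_of_int \<lfloor>4 * (s + W) / r\<rfloor> - real_of_int \<lfloor>4 * s / r\<rfloor> + 1)"
    by (simp add: B_def card_cartesian_product)
  also have "\<dots> \<le> 17 * (4 * (s + W) / r - 4 * s / r + 2)"
  proof -
    have "real_of_int \<lfloor>x\<rfloor> - real_of_int \<lfloor>y\<rfloor> + 1 \<le> x - y + 2" for x y :: real by linarith
    then show ?thesis by (intro mult_left_mono) simp_all
  qed
  also have "\<dots> = 17 * (4 * W / r + 2)" by (simp add: distrib_left add_divide_distrib)
  finally show ?thesis using fin card by linarith
qed

section \<open>Points near one or two lines, and lines near a point\<close>

lemma points_near_line:
  assumes "0 < \<delta>" "\<delta> \<le> 1" "points_separated \<delta> P" "P \<subseteq> Q0" "\<bar>fst l\<bar> \<le> 1"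
  shows "finite {p \<in> P. near \<delta> p l} \<and> real (card {p \<in> P. near \<delta> p l}) \<le> 170 / \<delta>"
proof -
  have "finite {p \<in> P. near \<delta> p l} \<and>
      real (card {p \<in> P. near \<delta> p l}) \<le> 17 * (4 * 2 / \<delta> + 2)"
    using assms
    by (intro separated_strip_card[where s = "-1" and m = "fst l" and c = "snd l"])
      (auto simp: near_def Q0_def points_separated_def)
  \<comment> \<open>Since \<delta> \<le> 1, the summand 2 is at most 2 / \<delta>, and 17 * 10 =
    170.\<close>
  moreover have "17 * (4 * 2 / \<delta> + 2) \<le> 170 / \<delta>" using assms(1,2) by (simp add: field_simps)
  ultimately show ?thesis by linarith
qed

text \<open>Two strips of width comparable to \<delta> whose slopes differ by at least \<theta> meet
  only over an interval of length 8 \<delta> / \<theta>. The \<delta>-separated points in that piece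
  of one strip number O(1 / \<theta>), as \<delta> cancels.\<close>

lemma points_near_transversal_lines:
  assumes "0 < \<delta>" "points_separated \<delta> P" "\<bar>fst l\<bar> \<le> 1" "\<bar>fst l'\<bar> \<le> 1"
    and \<theta>: "0 < \<theta>" "\<theta> \<le> \<bar>fst l - fst l'\<bar>"
  shows "real (card {p \<in> P. near \<delta> p l \<and> near \<delta> p l'}) \<le> 612 / \<theta>"
proof -
  \<comment> \<open>The abscissa where the two lines cross. The difference of the vertical offsets
    from the two lines is linear in \<open>x\<close> and vanishes at \<open>x0\<close>.\<close>
  define x0 where "x0 = (snd l' - snd l) / (fst l - fst l')"
  have ne: "fst l \<noteq> fst l'" using \<theta> by auto
  have x: "\<bar>x - x0\<bar> \<le> 4 * \<delta> / \<theta>" if "near \<delta> (x, y) l" "near \<delta> (x, y) l'" for x y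
  proof -
    have "(fst l - fst l') * (x - x0) = (y - fst l' * x - snd l') - (y - fst l * x - snd l)"
    proof -
      have "(fst l - fst l') * x0 = snd l' - snd l" using ne by (simp add: x0_def)
      then show ?thesis by (simp add: algebra_simps)
    qed
    then have "\<bar>fst l - fst l'\<bar> * \<bar>x - x0\<bar> \<le> 4 * \<delta>"
      using that unfolding near_def abs_mult[symmetric] by simp
    moreover have "\<theta> * \<bar>x - x0\<bar> \<le> \<bar>fst l - fst l'\<bar> * \<bar>x - x0\<bar>"
      using \<theta> by (intro mult_right_mono) auto
    ultimately show ?thesis using \<theta>(1) by (simp add: field_simps)
  qed
  have "real (card {p \<in> P. near \<delta> p l \<and> near \<delta> p l'}) \<le> 17 * (4 * (8 * \<delta> / \<theta>) / \<delta> + 2)"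
  proof (rule conjunct2[OF separated_strip_card[where s = "x0 - 4 * \<delta> / \<theta>"
        and m = "fst l" and c = "snd l"]])
    fix x y assume "(x, y) \<in> {p \<in> P. near \<delta> p l \<and> near \<delta> p l'}"
    then have xy: "near \<delta> (x, y) l" "near \<delta> (x, y) l'" by auto
    show "x0 - 4 * \<delta> / \<theta> \<le> x \<and> x \<le> x0 - 4 * \<delta> / \<theta> + 8 * \<delta> / \<theta> \<and>
        \<bar>y - fst l * x - snd l\<bar> \<le> 2 * \<delta>"
      using x[OF xy] xy(1) by (auto simp: near_def abs_le_iff)
  qed (use assms in \<open>auto simp: points_separated_def\<close>)
  also have "\<dots> = 17 * (32 / \<theta> + 2)" using assms(1) by simp
  also have "\<dots> \<le> 612 / \<theta>"
  proof -
    \<comment> \<open>Thus 2 \<le> 4 / \<theta>, and 17 * (32 + 4) = 612.\<close>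
    have "\<theta> \<le> 2" using assms(3,4) \<theta>(2) by linarith
    then show ?thesis using \<theta>(1) by (simp add: field_simps)
  qed
  finally show ?thesis .
qed

text \<open>The dual use of the strip bound: in the coefficient plane, the lines near
  \<open>p\<close> fill a strip around the line of slope \<open>- fst p\<close> and intercept
  \<open>snd p\<close>. As \<delta> \<le> \<epsilon>, it can be counted at scale \<epsilon>.\<close>

lemma lines_near_point_similar_slope:
  assumes "0 < \<epsilon>" "\<delta> \<le> \<epsilon>" "points_separated \<epsilon> A" "p \<in> Q0" "0 \<le> t"
  shows "real (card {l \<in> A. near \<delta> p l \<and> \<bar>fst l - a\<bar> \<le> t}) \<le> 17 * (8 * t / \<epsilon> + 2)"
proof -
  have "real (card {l \<in> A. near \<delta> p l \<and> \<bar>fst l - a\<bar> \<le> t}) \<le> 17 * (4 * (2 * t) / \<epsilon> + 2)"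
  proof (rule conjunct2[OF separated_strip_card[where s = "a - t" and m = "- fst p" and c = "snd p"]])
    show "a - t \<le> u \<and> u \<le> a - t + 2 * t \<and> \<bar>v - - fst p * u - snd p\<bar> \<le> 2 * \<epsilon>"
      if "(u, v) \<in> {l \<in> A. near \<delta> p l \<and> \<bar>fst l - a\<bar> \<le> t}" for u v
      using that assms(2) by (auto simp: near_def abs_le_iff algebra_simps)
  qed (use assms in \<open>auto simp: points_separated_def Q0_def\<close>)
  then show ?thesis by simp
qed

text \<open>Distant coefficients need not have distant slopes. But if both lines are near a common
  point of \<open>Q0\<close>, their intercepts differ by at most 4 \<delta> more than their slopes,
  so the slopes are separated unless \<epsilon> is comparable to \<delta>. In that case the bound
  for a single line suffices.\<close>

lemma points_near_two_lines:
  assumes "0 < \<delta>" "\<delta> \<le> \<epsilon>" "\<epsilon> \<le> 1" "points_separated \<delta> P" "P \<subseteq> Q0"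
    and "\<bar>fst l\<bar> \<le> 1" "\<bar>fst l'\<bar> \<le> 1" "\<epsilon> \<le> dist l l'"
  shows "real (card {p \<in> P. near \<delta> p l \<and> near \<delta> p l'}) \<le> 2720 / \<epsilon>"
proof (cases "\<epsilon> \<le> 16 * \<delta>")
  case True
  have "finite {p \<in> P. near \<delta> p l}" and *: "real (card {p \<in> P. near \<delta> p l}) \<le> 170 / \<delta>"
    using points_near_line[of \<delta> P l] assms by auto
  then have "card {p \<in> P. near \<delta> p l \<and> near \<delta> p l'} \<le> card {p \<in> P. near \<delta> p l}"
    by (intro card_mono) auto
  \<comment> \<open>The constant is 170 * 16 = 2720.\<close>
  moreover have "170 / \<delta> \<le> 2720 / \<epsilon>" using True assms(1,2) by (simp add: field_simps)
  ultimately show ?thesis using * by linarith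
next
  case False
  show ?thesis
  proof (cases "{p \<in> P. near \<delta> p l \<and> near \<delta> p l'} = {}")
    case True
    then show ?thesis using assms(1,2) by (simp only: card.empty) simp
  next
    case nonempty: False
    then obtain x y where xy: "(x, y) \<in> P" "near \<delta> (x, y) l" "near \<delta> (x, y) l'" by auto
    have "\<bar>x\<bar> \<le> 1" using subsetD[OF assms(5) xy(1)] by (auto simp: Q0_def)
    then have "\<bar>(fst l - fst l') * x\<bar> \<le> \<bar>fst l - fst l'\<bar>"
      using mult_left_mono[of "\<bar>x\<bar>" 1 "\<bar>fst l - fst l'\<bar>"] by (simp add: abs_mult)
    moreover have "snd l - snd l' =
        (y - fst l' * x - snd l') - (y - fst l * x - snd l) - (fst l - fst l') * x"
      by (simp add: algebra_simps)
    ultimately have "\<bar>snd l - snd l'\<bar> \<le> 4 * \<delta> + \<bar>fst l - fst l'\<bar>"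
      using xy(2,3) by (simp add: near_def)
    moreover have "dist l l' \<le> \<bar>fst l - fst l'\<bar> + \<bar>snd l - snd l'\<bar>" by (rule dist_le_sum_abs)
    \<comment> \<open>Here \<epsilon> is at most twice the slope difference plus 4 \<delta>, and 4
      \<delta> < \<epsilon> / 4.\<close>
    ultimately have "3 * \<epsilon> / 8 \<le> \<bar>fst l - fst l'\<bar>" using False assms(8) by linarith
    then have "real (card {p \<in> P. near \<delta> p l \<and> near \<delta> p l'}) \<le> 612 / (3 * \<epsilon> / 8)"
      using assms by (intro points_near_transversal_lines) auto
    also have "\<dots> \<le> 2720 / \<epsilon>" using assms(1,2) by (simp add: field_simps)
    finally show ?thesis .
  qed
qed

section \<open>Counting points against pairs of lines\<close>

lemma double_counting:
  fixes M N :: real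
  assumes "finite P" "finite A"
    and "\<And>p. p \<in> P \<Longrightarrow> M \<le> real (card {z \<in> A. R p z})"
    and "\<And>z. z \<in> A \<Longrightarrow> real (card {p \<in> P. R p z}) \<le> N"
  shows "real (card P) * M \<le> real (card A) * N"
proof -
  have "real (card P) * M \<le> (\<Sum>p\<in>P. real (card {z \<in> A. R p z}))"
    using sum_mono[of P "\<lambda>_. M"] assms(3) by simp
  also have "\<dots> = (\<Sum>z\<in>A. real (card {p \<in> P. R p z}))"
    unfolding of_nat_sum[symmetric] of_nat_eq_iff
    by (rule sum_multicount_gen[symmetric]) (use assms in auto)
  also have "\<dots> \<le> real (card A) * N"
    using sum_mono[of A _ "\<lambda>_. N"] assms(4) by simp
  finally show ?thesis .
qed

text \<open>Each point of \<open>P\<close> is near both lines of at least k^2 / 4 ordered pairs that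
  are not \<open>close\<close>, and each such pair serves at most 369920 / (k \<epsilon>) points.
  Dividing yields the exponent 3 and the constant 4 * 369920 = 1479680.\<close>

lemma card_rich_points_le:
  fixes \<delta> \<epsilon> :: real
  assumes \<delta>: "0 < \<delta>" "\<delta> \<le> \<epsilon>" "\<epsilon> \<le> 1"
    and A: "finite A" "points_separated \<epsilon> A" "\<And>l. l \<in> A \<Longrightarrow> \<bar>fst l\<bar> \<le> 1"
    and k: "2 \<le> k"
    and P: "P \<subseteq> Q0" "points_separated \<delta> P" "\<And>p. p \<in> P \<Longrightarrow> k \<le> card {l \<in> A. near \<delta> p l}"
  shows "finite P \<and> real (card P) \<le> 1479680 * ((real (card A))\<^sup>2 / real k ^ 3) * (1 / \<epsilon>)"
proof -
  have \<epsilon>: "0 < \<epsilon>" using \<delta> by linarith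
  have finite_P: "finite P"
  proof (rule finite_subset)
    show "P \<subseteq> (\<Union>l\<in>A. {p \<in> P. near \<delta> p l})"
    proof
      fix p assume p: "p \<in> P"
      then have "{l \<in> A. near \<delta> p l} \<noteq> {}" using P(3)[OF p] k by (intro notI) simp
      with p show "p \<in> (\<Union>l\<in>A. {p \<in> P. near \<delta> p l})" by auto
    qed
    show "finite (\<Union>l\<in>A. {p \<in> P. near \<delta> p l})"
      using points_near_line \<delta> P(1,2) A by (intro finite_UN_I) auto
  qed
  \<comment> \<open>The choice makes the main term 17 * 8 t / \<epsilon> of the count of lines of
    similar slope equal to k / 2.\<close>
  define t where "t = real k * \<epsilon> / 272"
  \<comment> \<open>For k \<ge> 136 the remaining term 34 is at most k / 4, so at most 3 k / 4 lines
    are \<open>close\<close> to a given one. For smaller k only the line itself counts as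
    \<open>close\<close>, and 1 \<le> 3 k / 4 because k \<ge> 2.\<close>
  define close where
    "close = (\<lambda>l l' :: real \<times> real. if 136 \<le> k then \<bar>fst l' - fst l\<bar> \<le> t else l' = l)"
  have t: "0 < t" using k \<epsilon> by (simp add: t_def)
  have few_close: "real (card {l' \<in> A. near \<delta> p l' \<and> close l l'}) \<le> 3 * real k / 4"
    if p: "p \<in> P" for p l
  proof (cases "136 \<le> k")
    case True
    have "real (card {l' \<in> A. near \<delta> p l' \<and> \<bar>fst l' - fst l\<bar> \<le> t}) \<le> 17 * (8 * t / \<epsilon> + 2)"
      using lines_near_point_similar_slope \<epsilon> \<delta>(2) A(2) P(1) p t by fastforce
    also have "\<dots> = real k / 2 + 34" using \<epsilon> by (simp add: t_def)
    finally show ?thesis using True by (simp add: close_def)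
  next
    case False
    then have "card {l' \<in> A. near \<delta> p l' \<and> close l l'} \<le> card {l}"
      by (intro card_mono) (auto simp: close_def)
    then show ?thesis using k by simp
  qed
  \<comment> \<open>The constant 369920 = 2720 * 136 comes from k < 136; for larger k, 612 * 272
    would do.\<close>
  have "real (card P) * ((real k)\<^sup>2 / 4) \<le> real (card (A \<times> A)) * (369920 / (real k * \<epsilon>))"
  proof (rule double_counting[where
      R = "\<lambda>p (l, l'). near \<delta> p l \<and> near \<delta> p l' \<and> \<not> close l l'"])
    fix p assume p: "p \<in> P"
    define B where "B = {l \<in> A. near \<delta> p l}"
    have B: "finite B" "k \<le> card B" using A(1) P(3)[OF p] by (auto simp: B_def)
    have far: "real k / 4 \<le> real (card {l' \<in> B. \<not> close l l'})" for l
    proof -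
      have "card B = card {l' \<in> B. close l l'} + card {l' \<in> B. \<not> close l l'}"
        using B(1) by (subst card_Un_disjoint[symmetric]) (auto intro: arg_cong[where f = card])
      moreover have "{l' \<in> B. close l l'} = {l' \<in> A. near \<delta> p l' \<and> close l l'}"
        by (auto simp: B_def)
      ultimately show ?thesis using few_close[OF p, of l] B(2) by simp
    qed
    have "{z \<in> A \<times> A. case z of (l, l') \<Rightarrow> near \<delta> p l \<and> near \<delta> p l' \<and> \<not> close l l'} =
        (SIGMA l:B. {l' \<in> B. \<not> close l l'})"
      by (auto simp: B_def)
    then have "real (card {z \<in> A \<times> A. case z of (l, l') \<Rightarrow>
        near \<delta> p l \<and> near \<delta> p l' \<and> \<not> close l l'}) = (\<Sum>l\<in>B. real (card {l' \<in> B. \<not> close l l'}))"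
      using B(1) by simp
    moreover have "real (card B) * (real k / 4) \<le> (\<Sum>l\<in>B. real (card {l' \<in> B. \<not> close l l'}))"
      using sum_mono[of B "\<lambda>_. real k / 4"] far by simp
    moreover have "real k * (real k / 4) \<le> real (card B) * (real k / 4)"
      using B(2) by (intro mult_right_mono) auto
    ultimately show "(real k)\<^sup>2 / 4 \<le> real (card {z \<in> A \<times> A. case z of (l, l') \<Rightarrow>
        near \<delta> p l \<and> near \<delta> p l' \<and> \<not> close l l'})"
      by (simp add: power2_eq_square)
  next
    fix z assume z: "z \<in> A \<times> A"
    obtain l l' where z_eq: "z = (l, l')" by (cases z)
    have l: "l \<in> A" "l' \<in> A" "\<bar>fst l\<bar> \<le> 1" "\<bar>fst l'\<bar> \<le> 1" using z A(3) by (auto simp: z_eq)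
    have "real (card {p \<in> P. near \<delta> p l \<and> near \<delta> p l'}) \<le> 369920 / (real k * \<epsilon>)"
      if far: "\<not> close l l'"
    proof (cases "136 \<le> k")
      case True
      have "real (card {p \<in> P. near \<delta> p l \<and> near \<delta> p l'}) \<le> 612 / t"
        using far True \<delta>(1) P(2) l t
        by (intro points_near_transversal_lines) (auto simp: close_def abs_minus_commute)
      also have "\<dots> \<le> 369920 / (real k * \<epsilon>)"
        using True \<epsilon> by (simp add: t_def divide_right_mono)
      finally show ?thesis .
    next
      case False
      have "\<epsilon> \<le> dist l l'" using far False A(2) l by (auto simp: close_def points_separated_def)
      then have "real (card {p \<in> P. near \<delta> p l \<and> near \<delta> p l'}) \<le> 2720 / \<epsilon>"
        using \<delta> P(1,2) l by (intro points_near_two_lines) auto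
      also have "\<dots> \<le> 369920 / (real k * \<epsilon>)"
        using False k \<epsilon> by (simp add: field_simps)
      finally show ?thesis .
    qed
    \<comment> \<open>For a \<open>close\<close> pair the set is empty, so the bound only has to be
      nonnegative.\<close>
    then show "real (card {p \<in> P. case z of (l, l') \<Rightarrow>
        near \<delta> p l \<and> near \<delta> p l' \<and> \<not> close l l'}) \<le> 369920 / (real k * \<epsilon>)"
      using \<epsilon> by (cases "close l l'") (auto simp: z_eq)
  qed (use finite_P A(1) in auto)
  then have "real (card P) \<le> real (card (A \<times> A)) * (369920 / (real k * \<epsilon>)) / ((real k)\<^sup>2 / 4)"
    using k by (subst pos_le_divide_eq) auto
  also have "\<dots> = 1479680 * ((real (card A))\<^sup>2 / real k ^ 3) * (1 / \<epsilon>)"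
    by (simp add: card_cartesian_product power2_eq_square power3_eq_cube)
  finally show ?thesis using finite_P by blast
qed

section \<open>Passage from lines to their coefficients\<close>

theorem theorem2p4:
  "\<exists>C::real. C \<ge> 1 \<and>
     (\<forall>(\<delta>::real) (\<epsilon>::real) (L :: (real \<times> real) set set) (k::nat) (P :: (real \<times> real) set).
        0 < \<delta> \<longrightarrow> \<delta> \<le> \<epsilon> \<longrightarrow> \<epsilon> \<le> 1 \<longrightarrow>
        L \<subseteq> lines_Q0 \<longrightarrow> finite L \<longrightarrow> lines_separated \<epsilon> L \<longrightarrow>
        2 \<le> k \<longrightarrow>
        P \<subseteq> Q0 \<longrightarrow> points_separated \<delta> P \<longrightarrow> (\<forall>p\<in>P. rich \<delta> L k p) \<longrightarrow>
        finite P \<and> real (card P) \<le> C * ((real (card L))\<^sup>2 / real k ^ 3) * (1 / \<epsilon>))"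
proof (intro exI[of _ 1479680] conjI[of "_ \<ge> _"] allI impI)
  fix \<delta> \<epsilon> :: real and L :: "(real \<times> real) set set" and k :: nat and P :: "(real \<times> real) set"
  assume \<delta>: "0 < \<delta>" "\<delta> \<le> \<epsilon>" "\<epsilon> \<le> 1"
    and L: "L \<subseteq> lines_Q0" "finite L" "lines_separated \<epsilon> L"
    and k: "2 \<le> k"
    and P: "P \<subseteq> Q0" "points_separated \<delta> P" "\<forall>p\<in>P. rich \<delta> L k p"
  \<comment> \<open>By injectivity of \<open>line\<close>, this set of coefficients inherits the
    cardinality, the separation and the slope bound of \<open>L\<close>.\<close>
  define A where "A = line -` L"
  have inj: "inj_on line S" for S using inj_line by (rule inj_on_subset) simp
  have L_eq: "L = line ` A" using L(1) by (auto simp: A_def lines_Q0_def)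
  have slope: "\<bar>fst l\<bar> \<le> 1" if l: "l \<in> A" for l
  proof -
    have "line l \<in> lines_Q0" using l L(1) by (auto simp: A_def)
    then obtain a b where ab: "line l = line (a, b)" "\<bar>a\<bar> \<le> 1" by (auto simp: lines_Q0_def)
    show ?thesis using injD[OF inj_line ab(1)] ab(2) by simp
  qed
  have finite_A: "finite A" unfolding A_def using L(2) inj_line by (rule finite_vimageI)
  have card_A: "card L = card A" unfolding L_eq by (rule card_image) (rule inj)
  have sep: "points_separated \<epsilon> A"
    using L(3) injD[OF inj_line]
    by (fastforce simp: points_separated_def lines_separated_def A_def line_dist_line[symmetric])
  have "k \<le> card {l \<in> A. near \<delta> p l}" if p: "p \<in> P" for p
  proof -
    have "k \<le> card {m \<in> L. incident \<delta> p m}" using P(3) p by (simp add: rich_def)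
    also have "{m \<in> L. incident \<delta> p m} \<subseteq> line ` {l \<in> A. near \<delta> p l}"
      using slope by (fastforce simp: L_eq intro: incident_line_imp_near)
    then have "card {m \<in> L. incident \<delta> p m} \<le> card (line ` {l \<in> A. near \<delta> p l})"
      using finite_A by (intro card_mono) auto
    also have "\<dots> = card {l \<in> A. near \<delta> p l}" by (rule card_image) (rule inj)
    finally show ?thesis .
  qed
  then show "finite P \<and>
      real (card P) \<le> 1479680 * ((real (card L))\<^sup>2 / real k ^ 3) * (1 / \<epsilon>)"
    unfolding card_A using \<delta> finite_A sep slope k P(1,2) by (intro card_rich_points_le) auto
qed simp

end
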